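(* Let $\alpha,\beta\in\mathbb{N}$ and let $a,b,c\in\mathbb{C}$ with $c\notin\{0,-1,-2,\dots\}$, $a-b\in\mathbb{N}$, and $$\operatorname{Re}(a+b+\alpha+\beta-c-1)>0.$$ Then $$\lim_{z\to 1}(1-z)^{a+b+\alpha+\beta-c-1}\Big((a)_\alpha (b)_\beta\,{}_2F_1(a+\alpha,b+\beta;c;z)-(a)_\beta (b)_\alpha\,{}_2F_1(a+\beta,b+\alpha;c;z)\Big)$$ $$=\frac{\Gamma(c)}{\Gamma(a)\Gamma(b)}\,\Gamma(a+b+\alpha+\beta-c-1)\,(a-b)(\alpha-\beta).$$
   Context: $\mathbb{N}$ denotes the set of non-negative integers. The Pochhammer symbol is $(x)_0=1$ and $(x)_n=x(x+1)\cdots(x+n-1)$ for $n\ge 1$. For $c\notin\{0,-1,-2,\dots\}$ and $|z|<1$, the hypergeometric function is ${}_2F_1(a,b;c;z)=\sum_{n\ge 0}\frac{(a)_n(b)_n}{(c)_n}\frac{z^n}{n!}$. The limit $z\to1$ is taken through points $z$ with $|z|<1$, and $(1-z)^s=\exp(s\log(1-z))$ with the principal branch of the logarithm. $\Gamma$ is the Euler Gamma function, and $1/\Gamma$ is understood as the entire function vanishing at $0,-1,-2,\dots$. *)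

theory Defs
  imports "HOL-Analysis.Analysis"
begin

text \<open>
  The Gauss series. It is meaningful for \<open>c \<notin> {0, -1, -2, \<dots>}\<close> and \<open>norm z < 1\<close>;
  outside these ranges the value is an artefact of division by zero or of
  \<open>suminf\<close> on a divergent series.
\<close>

definition hypergeo_2F1 :: "complex \<Rightarrow> complex \<Rightarrow> complex \<Rightarrow> complex \<Rightarrow> complex" where
  "hypergeo_2F1 a b c z =
     (\<Sum>n. pochhammer a n * pochhammer b n / pochhammer c n * (z ^ n / fact n))"

lemma hypergeo_2F1_eq_eval_fps:
  "hypergeo_2F1 a b c z = eval_fps (fps_hypergeo [a, b] [c] 1) z"
  by (simp add: hypergeo_2F1_def eval_fps_def field_simps)

end

theory Submission
  imports Defs
begin

text \<open>
  By Euler's transformation,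
  \<open>F(a, b; c; z) = (1 - z)\<^sup>-\<^sup>s\<^sup>-\<^sup>1 G(z)\<close> with \<open>G = F(c - a, c - b; c; \<cdot>)\<close> and \<open>s = a + b - c - 1\<close>.
  If \<open>Re s > 0\<close>, the coefficients \<open>g\<^sub>n\<close> of \<open>G\<close> satisfy \<open>\<Sum> n |g\<^sub>n| < \<infinity>\<close>, so by dominated convergence
  the difference quotient of \<open>G\<close> at \<open>1\<close> tends to \<open>G'(1)\<close> along the whole disc, tangential approach
  included, and Gauss's summation theorem evaluates \<open>G(1)\<close> and \<open>G'(1)\<close>. For the two functions in
  the theorem the terms with \<open>G(1)\<close> coincide after scaling by the Pochhammer symbols
  and cancel, and the terms with \<open>G'(1)\<close> give the limit because
  \<open>(c-a-\<beta>)(c-b-\<alpha>) - (c-a-\<alpha>)(c-b-\<beta>) = (a-b)(\<alpha>-\<beta>)\<close>.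
\<close>

unbundle no vec_syntax
unbundle fps_syntax

section \<open>Coefficients and radius of convergence of the Gauss series\<close>

text \<open>Working with the formal series makes Euler's transformation an identity of coefficients;
  evaluation in the disc and summation at 1 come afterwards.\<close>

abbreviation fps_2F1 :: "complex \<Rightarrow> complex \<Rightarrow> complex \<Rightarrow> complex fps" where
  "fps_2F1 a b c \<equiv> fps_hypergeo [a, b] [c] 1"

lemma fps_2F1_nth:
  "fps_2F1 a b c $ n = pochhammer a n * pochhammer b n / (pochhammer c n * fact n)"
  by simp

lemma fps_2F1_nth_Suc:
  "fps_2F1 a b c $ Suc n =
     (a + of_nat n) * (b + of_nat n) / ((c + of_nat n) * of_nat (Suc n)) * fps_2F1 a b c $ n"
  by (simp add: pochhammer_Suc field_simps)

lemma add_of_nat_neq_0: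
  assumes "(c :: complex) \<notin> \<int>\<^sub>\<le>\<^sub>0"
  shows "c + of_nat n \<noteq> 0"
  using assms by (metis add_eq_0_iff2 minus_of_nat_in_nonpos_Ints)

lemma add_of_nat_notin_nonpos_Ints:
  assumes "(c :: complex) \<notin> \<int>\<^sub>\<le>\<^sub>0"
  shows "c + of_nat n \<notin> \<int>\<^sub>\<le>\<^sub>0"
proof
  assume "c + of_nat n \<in> \<int>\<^sub>\<le>\<^sub>0"
  then obtain m where "c + of_nat n = - of_nat m"
    by (elim nonpos_Ints_cases')
  hence "c + of_nat (n + m) = 0"
    by (simp add: add.assoc[symmetric])
  with add_of_nat_neq_0[OF assms, of "n + m"] show False
    by blast
qed

lemma inverse_add_of_nat_tendsto_0: "(\<lambda>n. inverse (c + of_nat n :: complex)) \<longlonglongrightarrow> 0"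
  by (intro filterlim_compose[OF tendsto_inverse_0] tendsto_add_filterlim_at_infinity[of _ c])
     (auto intro!: tendsto_of_nat)

lemma add_of_nat_ratio_tendsto_1: "(\<lambda>n. (a + of_nat n) / (c + of_nat n) :: complex) \<longlonglongrightarrow> 1"
proof -
  have "(\<lambda>n. 1 + (a - c) * inverse (c + of_nat n)) \<longlonglongrightarrow> 1 + (a - c) * 0"
    by (intro tendsto_intros inverse_add_of_nat_tendsto_0)
  moreover have "eventually (\<lambda>n. c + of_nat n \<noteq> 0) sequentially"
    using eventually_gt_at_top[of "nat \<lceil>norm c\<rceil>"]
  proof eventually_elim
    case (elim n)
    hence "norm c < real n" by linarith
    thus ?case
      by (metis add_eq_0_iff norm_minus_cancel norm_of_nat order_less_irrefl)
  qed
  hence "eventually (\<lambda>n. 1 + (a - c) * inverse (c + of_nat n) = (a + of_nat n) / (c + of_nat n))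
           sequentially"
    by eventually_elim (simp add: field_simps)
  ultimately show ?thesis
    using tendsto_cong by force
qed

text \<open>Ratio test: at a real point \<open>r\<close> the quotients of consecutive terms tend to
  \<open>r\<close>. The radius exceeds 1 when the series terminates, hence only a lower
  bound.\<close>

lemma fps_conv_radius_2F1: "fps_conv_radius (fps_2F1 a b c) \<ge> 1"
  unfolding fps_conv_radius_def
proof (rule conv_radius_geI_ex)
  fix r :: real
  assume r: "0 < r" "ereal r < 1"
  \<comment> \<open>The midpoint between \<open>r\<close> and 1: eventually above the ratios, still
    below 1.\<close>
  define R where "R = (1 + r) / 2"
  let ?q = "\<lambda>n. (a + of_nat n) / (c + of_nat n) * ((b + of_nat n) / (1 + of_nat n)) * complex_of_real r"
  have "(\<lambda>n. norm (?q n)) \<longlonglongrightarrow> norm (1 * 1 * complex_of_real r)"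
    by (intro tendsto_intros add_of_nat_ratio_tendsto_1)
  moreover have "norm (1 * 1 * complex_of_real r) < R" and R: "R < 1"
    using r by (simp_all add: R_def)
  ultimately have "eventually (\<lambda>n. norm (?q n) < R) sequentially"
    by (simp only: order_tendstoD)
  then obtain N where N: "\<And>n. n \<ge> N \<Longrightarrow> norm (?q n) < R"
    by (auto simp: eventually_at_top_linorder)
  have "summable (\<lambda>n. fps_2F1 a b c $ n * of_real r ^ n)"
  proof (rule summable_ratio_test[OF R])
    fix n assume n: "n \<ge> N"
    have "fps_2F1 a b c $ Suc n * of_real r ^ Suc n = ?q n * (fps_2F1 a b c $ n * of_real r ^ n)"
      by (subst fps_2F1_nth_Suc) (simp add: mult_ac)
    hence "norm (fps_2F1 a b c $ Suc n * of_real r ^ Suc n)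
             = norm (?q n) * norm (fps_2F1 a b c $ n * of_real r ^ n)"
      by (metis norm_mult)
    also have "\<dots> \<le> R * norm (fps_2F1 a b c $ n * of_real r ^ n)"
      using N[OF n] by (intro mult_right_mono) auto
    finally show "norm (fps_2F1 a b c $ Suc n * of_real r ^ Suc n)
                    \<le> R * norm (fps_2F1 a b c $ n * of_real r ^ n)" .
  qed
  thus "\<exists>z. norm z = r \<and> summable (\<lambda>n. fps_2F1 a b c $ n * z ^ n)"
    using r by (intro exI[of _ "of_real r"]) auto
qed

section \<open>The hypergeometric differential equation and Euler's transformation\<close>

text \<open>The n-th coefficient of the differential operator applied to \<open>f\<close> is exactly
  the difference of the two sides of the recurrence. One direction gives the equation for a known
  series, the other recovers the coefficients of a solution.\<close>

lemma hypergeo_ODE_iff: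
  fixes f :: "complex fps"
  shows "fps_X * (1 - fps_X) * fps_deriv (fps_deriv f)
           + (fps_const c - fps_const (a + b + 1) * fps_X) * fps_deriv f
           - fps_const (a * b) * f = 0
         \<longleftrightarrow> (\<forall>n. of_nat (Suc n) * (c + of_nat n) * f $ Suc n
                    = (a + of_nat n) * (b + of_nat n) * f $ n)"
    (is "?L = 0 \<longleftrightarrow> _")
proof -
  have "?L = fps_X * fps_deriv (fps_deriv f) - fps_X * (fps_X * fps_deriv (fps_deriv f))
               + fps_const c * fps_deriv f - fps_const (a + b + 1) * (fps_X * fps_deriv f)
               - fps_const (a * b) * f" (is "_ = ?L'")
    by (simp add: algebra_simps)
  moreover have "?L' $ n = of_nat (Suc n) * (c + of_nat n) * f $ Suc n
                    - (a + of_nat n) * (b + of_nat n) * f $ n" for n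
    \<comment> \<open>The second derivative occurs multiplied by \<open>fps_X\<close> once and
      twice, so the indices 0 and 1 are separate cases.\<close>
    by (cases n; cases "n - 1") (auto simp: algebra_simps)
  ultimately show ?thesis
    by (simp only: fps_eq_iff fps_zero_nth right_minus_eq)
qed

text \<open>The condition on \<open>c\<close> keeps the factor of the next coefficient nonzero, so
  the recurrence determines everything from the constant term.\<close>

lemma fps_2F1_unique:
  assumes "c \<notin> \<int>\<^sub>\<le>\<^sub>0" and "f $ 0 = 1"
    and "\<And>n. of_nat (Suc n) * (c + of_nat n) * f $ Suc n = (a + of_nat n) * (b + of_nat n) * f $ n"
  shows "f = fps_2F1 a b c"
proof (rule fps_ext)
  fix n
  show "f $ n = fps_2F1 a b c $ n"
  proof (induction n)
    case (Suc n)
    have "of_nat (Suc n) * (c + of_nat n) \<noteq> 0"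
      using add_of_nat_neq_0[OF assms(1)] by (simp del: of_nat_Suc)
    hence "f $ Suc n = (a + of_nat n) * (b + of_nat n) * f $ n / (of_nat (Suc n) * (c + of_nat n))"
      using assms(3)[of n] by (metis nonzero_mult_div_cancel_left)
    with Suc show ?case
      by (subst fps_2F1_nth_Suc) (simp add: mult_ac)
  qed (use assms(2) in simp)
qed

lemma fps_2F1_recurrence:
  assumes "c \<notin> \<int>\<^sub>\<le>\<^sub>0"
  shows "of_nat (Suc n) * (c + of_nat n) * fps_2F1 a b c $ Suc n
           = (a + of_nat n) * (b + of_nat n) * fps_2F1 a b c $ n"
  using add_of_nat_neq_0[OF assms, of n]
  by (subst fps_2F1_nth_Suc) (simp del: of_nat_Suc fps_hypergeo_nth)

text \<open>With both other parameters equal to 1 the series is the binomial series of (1 - X)^(-s);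
  this is its logarithmic derivative s / (1 - X), cleared of the denominator.\<close>

lemma fps_binomial_1_minus_X_deriv:
  "(1 - fps_X) * fps_deriv (fps_2F1 s 1 1) = fps_const s * fps_2F1 s 1 1"
proof (rule fps_ext)
  fix n
  let ?P = "fps_2F1 s 1 1"
  have "1 + of_nat n \<noteq> (0 :: complex)"
    by (metis of_nat_Suc of_nat_neq_0)
  hence "of_nat (Suc n) * ?P $ Suc n = (s + of_nat n) * ?P $ n"
    by (subst fps_2F1_nth_Suc) (simp del: fps_hypergeo_nth)
  moreover have "((1 - fps_X) * fps_deriv ?P) $ n = of_nat (Suc n) * ?P $ Suc n - of_nat n * ?P $ n"
    by (cases n) (simp_all add: left_diff_distrib del: of_nat_Suc fps_hypergeo_nth)
  ultimately show "((1 - fps_X) * fps_deriv ?P) $ n = (fps_const s * ?P) $ n"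
    by (simp add: algebra_simps del: of_nat_Suc fps_hypergeo_nth)
qed

text \<open>
  Both sides have constant term \<open>1\<close> and satisfy the hypergeometric differential equation. The equation
  for the product is checked after multiplication by \<open>D = 1 - X\<close>, so that the logarithmic derivative of
  the binomial factor stays polynomial.
\<close>

theorem fps_2F1_Euler:
  assumes c: "c \<notin> \<int>\<^sub>\<le>\<^sub>0"
  shows "fps_2F1 a b c = fps_2F1 (a + b - c) 1 1 * fps_2F1 (c - a) (c - b) c"
proof -
  define s where "s = a + b - c"
  define P where "P = fps_2F1 s 1 1"
  define G where "G = fps_2F1 (c - a) (c - b) c"
  define D where "D = 1 - (fps_X :: complex fps)"
  define P' where "P' = fps_deriv P"
  define P'' where "P'' = fps_deriv P'"
  define G' where "G' = fps_deriv G"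
  define G'' where "G'' = fps_deriv G'"
  define S where "S = fps_const s"
  define A where "A = fps_const a"
  define B where "B = fps_const b"
  define C where "C = fps_const c"
  have X: "fps_X = 1 - D" by (simp add: D_def)
  have S: "S = A + B - C" by (simp add: S_def A_def B_def C_def s_def)
  have P': "D * P' = S * P"
    using fps_binomial_1_minus_X_deriv by (simp add: D_def P'_def P_def S_def)
  have "fps_deriv (D * P') = fps_deriv (S * P)" by (simp only: P')
  hence P'': "D * P'' = (S + 1) * P'"
    by (simp add: D_def S_def P''_def P'_def algebra_simps)
  have coeffs: "fps_const (c - a + (c - b) + 1) = (C - A) + (C - B) + 1"
              "fps_const ((c - a) * (c - b)) = (C - A) * (C - B)"
    by (simp_all only: A_def B_def C_def fps_const_sub fps_const_add fps_const_mult
          flip: fps_const_1_eq_1)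
  have ODE_G: "(1 - D) * D * G'' + (C - ((C - A) + (C - B) + 1) * (1 - D)) * G'
                 - (C - A) * (C - B) * G = 0"
    using iffD2[OF hypergeo_ODE_iff, OF allI, OF fps_2F1_recurrence[OF c], of "c - a" "c - b"]
    unfolding coeffs G_def[symmetric] G'_def[symmetric] G''_def[symmetric] C_def[symmetric]
    by (simp add: X)
  let ?H = "(1 - D) * D * (P * G'' + 2 * P' * G' + P'' * G)
              + (C - (A + B + 1) * (1 - D)) * (P * G' + P' * G) - A * B * (P * G)"
  have DP'': "D * (D * P'') = (S + 1) * (S * P)"
    by (simp only: P'' mult.left_commute[of D] P')
  have "D * ?H = (1 - D) * (D * D * P * G'' + 2 * D * (D * P') * G' + D * (D * P'') * G)
              + (C - (A + B + 1) * (1 - D)) * (D * P * G' + (D * P') * G) - A * B * D * P * G"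
    by (simp only: algebra_simps)
  also have "\<dots> = P * D * ((1 - D) * D * G'' + (C - ((C - A) + (C - B) + 1) * (1 - D)) * G'
                 - (C - A) * (C - B) * G)"
    \<comment> \<open>Once the derivatives of \<open>P\<close> are eliminated, inserting
      \<open>S = A + B - C\<close> turns the expression into a multiple of the equation for
      \<open>G\<close>.\<close>
    unfolding P' DP'' unfolding S by (simp add: algebra_simps)
  finally have "D * ?H = 0"
    by (simp only: ODE_G mult_zero_right)
  moreover have "D \<noteq> 0"
    by (simp add: D_def)
  ultimately have "?H = 0" by simp
  moreover have "?H = fps_X * (1 - fps_X) * fps_deriv (fps_deriv (P * G))
           + (fps_const c - fps_const (a + b + 1) * fps_X) * fps_deriv (P * G)
           - fps_const (a * b) * (P * G)"
    by (simp add: P'_def P''_def G'_def G''_def A_def B_def C_def D_def algebra_simps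
             flip: fps_const_add fps_const_mult)
  ultimately have "P * G = fps_2F1 a b c"
    by (intro fps_2F1_unique[OF c] iffD1[OF hypergeo_ODE_iff, rule_format])
       (simp_all add: P_def G_def)
  thus ?thesis
    by (simp add: P_def G_def s_def)
qed

text \<open>Newton's binomial series with exponent \<open>- s\<close> at \<open>- z\<close>: the
  sign of the binomial coefficient cancels that of the power.\<close>

lemma eval_fps_binomial_1_minus_X:
  assumes "norm z < 1"
  shows "eval_fps (fps_2F1 s 1 1) z = (1 - z) powr (- s)"
proof -
  have "(\<lambda>n. ((- s) gchoose n) * (- z) ^ n) sums (1 + (- z)) powr (- s)"
    using assms by (intro gen_binomial_complex) simp
  moreover have "((- s) gchoose n) * (- z) ^ n = fps_2F1 s 1 1 $ n * z ^ n" for n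
  proof -
    have "((- s) gchoose n) * (- z) ^ n = ((- 1) ^ n * (- 1) ^ n) * (pochhammer s n / fact n * z ^ n)"
      by (simp add: gbinomial_pochhammer power_minus[of z])
    also have "(- 1) ^ n * (- 1) ^ n = (1 :: complex)"
      by (simp flip: power_mult_distrib)
    finally show ?thesis
      by (simp add: pochhammer_fact[symmetric])
  qed
  ultimately show ?thesis
    by (simp add: eval_fps_def sums_iff)
qed

lemma eval_fps_2F1_Euler:
  assumes "c \<notin> \<int>\<^sub>\<le>\<^sub>0" and z: "norm z < 1"
  shows "eval_fps (fps_2F1 a b c) z
           = (1 - z) powr (c - a - b) * eval_fps (fps_2F1 (c - a) (c - b) c) z"
proof -
  have "ereal (norm z) < fps_conv_radius (fps_2F1 a' b' c')" for a' b' c'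
    using fps_conv_radius_2F1[of a' b' c'] z
    by (metis ereal_less(3) order_less_le_trans)
  thus ?thesis
    by (simp add: fps_2F1_Euler[OF assms(1), of a b] eval_fps_mult eval_fps_binomial_1_minus_X[OF z] diff_diff_eq
             del: fps_hypergeo_nth)
qed

section \<open>Growth of the coefficients and summability at 1\<close>

text \<open>\<open>rGamma_series\<close> is Gauss's product for 1/Gamma, built from a Pochhammer
  symbol with n + 1 factors; hence the index \<open>Suc n\<close>. A quotient of three such products
  equals the left side up to the power n^(a+b-c), and it is bounded because it converges, the limit
  of its denominator being nonzero.\<close>

lemma fps_2F1_nth_bound:
  assumes c: "c \<notin> \<int>\<^sub>\<le>\<^sub>0"
  obtains K where "\<And>n. n > 0 \<Longrightarrow>
    real (Suc n) * norm (fps_2F1 a b c $ Suc n) \<le> K * real n powr Re (a + b - c)"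
proof -
  let ?r = "\<lambda>n. rGamma_series a n * rGamma_series b n / rGamma_series c n"
  have "rGamma c \<noteq> 0"
    using c by (simp add: rGamma_eq_zero_iff)
  hence "?r \<longlonglongrightarrow> rGamma a * rGamma b / rGamma c"
    by (intro tendsto_intros)
  hence "Bseq ?r"
    by (intro convergent_imp_Bseq) (auto simp: convergent_def)
  then obtain K where K: "\<And>n. norm (?r n) \<le> K"
    by (auto simp: Bseq_def)
  show ?thesis
  proof (rule that[of K])
    fix n :: nat
    assume n: "n > 0"
    let ?e = "\<lambda>x. exp (x * of_real (ln (of_nat n)))"
    have "of_nat (Suc n) * fps_2F1 a b c $ Suc n
            = pochhammer a (Suc n) * pochhammer b (Suc n) / (pochhammer c (Suc n) * fact n)"
      by (simp add: fps_2F1_nth del: of_nat_Suc fps_hypergeo_nth)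
    also have "\<dots> = ?r n * (?e a * ?e b / ?e c)"
      by (simp add: rGamma_series_def)
    also have "?e a * ?e b / ?e c = ?e (a + b - c)"
      by (simp add: exp_add exp_diff ring_distribs)
    finally have "real (Suc n) * norm (fps_2F1 a b c $ Suc n) = norm (?r n) * norm (?e (a + b - c))"
      by (metis norm_mult norm_of_nat)
    \<comment> \<open>Here n > 0 matters: \<open>powr\<close> is 0 at base 0, the exponential never
      is.\<close>
    also have "norm (?e (a + b - c)) = real n powr Re (a + b - c)"
      using n by (simp add: powr_def)
    also have "norm (?r n) * real n powr Re (a + b - c) \<le> K * real n powr Re (a + b - c)"
      by (intro mult_right_mono K) auto
    finally show "real (Suc n) * norm (fps_2F1 a b c $ Suc n) \<le> K * real n powr Re (a + b - c)" .
  qed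
qed

text \<open>Provides the vanishing boundary term for the telescoping sum in the contiguous
  relation.\<close>

lemma of_nat_mult_fps_2F1_nth_tendsto_0:
  assumes c: "c \<notin> \<int>\<^sub>\<le>\<^sub>0" and "Re (c - a - b) > 0"
  shows "(\<lambda>n. of_nat n * fps_2F1 a b c $ n) \<longlonglongrightarrow> 0"
proof -
  obtain K where K: "\<And>n. n > 0 \<Longrightarrow>
      real (Suc n) * norm (fps_2F1 a b c $ Suc n) \<le> K * real n powr Re (a + b - c)"
    using fps_2F1_nth_bound[OF c] by blast
  have "(\<lambda>n. real n powr Re (a + b - c)) \<longlonglongrightarrow> 0"
    using assms(2) by (intro tendsto_neg_powr filterlim_real_sequentially) simp
  hence lim: "(\<lambda>n. K * real n powr Re (a + b - c)) \<longlonglongrightarrow> 0"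
    using tendsto_mult_right_zero by blast
  have "eventually (\<lambda>n. norm (of_nat (Suc n) * fps_2F1 a b c $ Suc n)
                          \<le> K * real n powr Re (a + b - c)) sequentially"
    using eventually_gt_at_top[of 0]
    by eventually_elim (metis K norm_mult norm_of_nat)
  hence "(\<lambda>n. of_nat (Suc n) * fps_2F1 a b c $ Suc n) \<longlonglongrightarrow> 0"
    using lim by (rule Lim_null_comparison)
  thus ?thesis
    by (rule LIMSEQ_imp_Suc)
qed

text \<open>Dividing the coefficient bound by n lowers the exponent to Re (a + b - c) - 1 <
  -1.\<close>

lemma summable_norm_fps_2F1_nth:
  assumes c: "c \<notin> \<int>\<^sub>\<le>\<^sub>0" and "Re (c - a - b) > 0"
  shows "summable (\<lambda>n. norm (fps_2F1 a b c $ n))"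
proof -
  obtain K where K: "\<And>n. n > 0 \<Longrightarrow>
      real (Suc n) * norm (fps_2F1 a b c $ Suc n) \<le> K * real n powr Re (a + b - c)"
    using fps_2F1_nth_bound[OF c] by blast
  have "summable (\<lambda>n. K * real n powr (Re (a + b - c) - 1))"
    using assms(2) by (intro summable_mult) (simp add: summable_real_powr_iff)
  moreover have "norm (norm (fps_2F1 a b c $ Suc n)) \<le> K * real n powr (Re (a + b - c) - 1)"
    if "n \<ge> 1" for n
  proof -
    have "real n * norm (fps_2F1 a b c $ Suc n) \<le> real (Suc n) * norm (fps_2F1 a b c $ Suc n)"
      by (intro mult_right_mono) auto
    also have "\<dots> \<le> K * real n powr Re (a + b - c)"
      using that by (intro K) auto
    finally show ?thesis
      using that by (simp add: powr_diff pos_le_divide_eq mult_ac del: fps_hypergeo_nth)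
  qed
  ultimately have "summable (\<lambda>n. norm (fps_2F1 a b c $ Suc n))"
    by (rule summable_comparison_test')
  thus ?thesis
    by (rule summable_Suc_iff[THEN iffD1])
qed

lemma summable_of_nat_mult_norm_fps_2F1_nth:
  assumes c: "c \<notin> \<int>\<^sub>\<le>\<^sub>0" and "Re (c - a - b) > 1"
  shows "summable (\<lambda>n. real n * norm (fps_2F1 a b c $ n))"
proof -
  obtain K where K: "\<And>n. n > 0 \<Longrightarrow>
      real (Suc n) * norm (fps_2F1 a b c $ Suc n) \<le> K * real n powr Re (a + b - c)"
    using fps_2F1_nth_bound[OF c] by blast
  have "summable (\<lambda>n. K * real n powr Re (a + b - c))"
    using assms(2) by (intro summable_mult) (simp add: summable_real_powr_iff)
  moreover have "norm (real (Suc n) * norm (fps_2F1 a b c $ Suc n)) \<le> K * real n powr Re (a + b - c)"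
    if "n \<ge> 1" for n
    using K[of n] that by (simp del: of_nat_Suc fps_hypergeo_nth)
  ultimately have "summable (\<lambda>n. real (Suc n) * norm (fps_2F1 a b c $ Suc n))"
    by (rule summable_comparison_test')
  thus ?thesis
    by (rule summable_Suc_iff[THEN iffD1])
qed

section \<open>Gauss's summation theorem\<close>

text \<open>Factor by factor, the modulus is at least the real part. This bounds denominators from
  below uniformly in a shift of \<open>c\<close> to the right.\<close>

lemma norm_pochhammer_add_ge:
  assumes "0 < x" and "x \<le> Re c"
  shows "pochhammer x k \<le> norm (pochhammer c k)"
  unfolding pochhammer_prod prod_norm[symmetric]
proof (rule prod_mono, intro conjI)
  fix i
  show "0 \<le> x + of_nat i"
    using assms by simp
  have "x + of_nat i \<le> Re (c + of_nat i)"
    using assms by simp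
  thus "x + of_nat i \<le> norm (c + of_nat i)"
    using complex_Re_le_cmod order_trans by blast
qed

text \<open>As the lower parameter grows, every term except the constant one tends to 0; Tannery's
  theorem allows passing to the limit under the sum.\<close>

lemma suminf_fps_2F1_shift_tendsto_1:
  "(\<lambda>n. \<Sum>k. fps_2F1 a b (c + of_nat n) $ k) \<longlonglongrightarrow> 1"
proof -
  \<comment> \<open>The majorant is the series with lower parameter \<open>x\<close>: beyond Re (a +
    b) it converges absolutely at 1, and for n >= \<open>N\<close> the real part of c + n is at
    least \<open>x\<close>.\<close>
  obtain x :: nat where x: "real x > max 0 (Re (a + b))"
    using reals_Archimedean2 by blast
  obtain N :: nat where N: "real N > real x - Re c"
    using reals_Archimedean2 by blast
  let ?M = "\<lambda>k. norm (fps_2F1 a b (of_nat x) $ k)"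
  have "complex_of_nat x \<notin> \<int>\<^sub>\<le>\<^sub>0"
    using x by (auto elim!: nonpos_Ints_cases' simp: complex_eq_iff)
  hence M: "summable ?M"
    using x by (intro summable_norm_fps_2F1_nth) auto
  have bound: "norm (fps_2F1 a b (c + of_nat n) $ k) \<le> ?M k" if "n \<ge> N" for n k
  proof -
    have "0 < pochhammer (real x) k"
      using x by (intro pochhammer_pos) auto
    moreover have "pochhammer (real x) k \<le> norm (pochhammer (c + of_nat n) k)"
      using x N that by (intro norm_pochhammer_add_ge) auto
    moreover have "norm (pochhammer (of_nat x :: complex) k) = pochhammer (real x) k"
      by (simp add: pochhammer_prod prod_norm[symmetric] flip: of_nat_add)
    ultimately show ?thesis
      unfolding fps_2F1_nth norm_divide norm_mult
      by (intro divide_left_mono mult_right_mono mult_pos_pos) auto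
  qed
  have lim: "(\<lambda>n. fps_2F1 a b (c + of_nat n) $ k) \<longlonglongrightarrow> (if k = 0 then 1 else 0)" for k
  proof (induction k)
    case (Suc k)
    have "(\<lambda>n. (a + of_nat k) * (b + of_nat k) / of_nat (Suc k) * inverse ((c + of_nat k) + of_nat n)
                 * fps_2F1 a b (c + of_nat n) $ k)
            \<longlonglongrightarrow> (a + of_nat k) * (b + of_nat k) / of_nat (Suc k) * 0 * (if k = 0 then 1 else 0)"
      by (intro tendsto_mult tendsto_const Suc inverse_add_of_nat_tendsto_0)
    thus ?case
      by (subst fps_2F1_nth_Suc) (simp add: field_simps del: of_nat_Suc fps_hypergeo_nth)
  qed simp
  have ev: "eventually (\<lambda>(k, n). norm (fps_2F1 a b (c + of_nat n) $ k) \<le> ?M k)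
          (at_top \<times>\<^sub>F sequentially)"
    unfolding eventually_prod_filter
    using bound eventually_ge_at_top[of N]
    by (intro exI[of _ "\<lambda>_. True"] exI[of _ "\<lambda>n. n \<ge> N"]) auto
  have "(\<lambda>n. \<Sum>k. fps_2F1 a b (c + of_nat n) $ k) \<longlonglongrightarrow> (\<Sum>k. if k = 0 then 1 else 0)"
    using tannerys_theorem[OF lim ev M] by simp
  thus ?thesis
    using suminf_finite[of "{0}" "\<lambda>k::nat. if k = 0 then 1 else 0 :: complex"] by simp
qed

text \<open>Termwise the difference of the two sides telescopes; the primitive is \<open>c n t\<^sub>n\<close>.\<close>

lemma suminf_fps_2F1_contiguous:
  assumes c: "c \<notin> \<int>\<^sub>\<le>\<^sub>0" and "Re (c - a - b) > 0"
  shows "c * (c - a - b) * (\<Sum>n. fps_2F1 a b c $ n)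
           = (c - a) * (c - b) * (\<Sum>n. fps_2F1 a b (c + 1) $ n)"
proof -
  let ?t = "\<lambda>n. fps_2F1 a b c $ n" and ?t' = "\<lambda>n. fps_2F1 a b (c + 1) $ n"
  have c1: "c + 1 \<notin> \<int>\<^sub>\<le>\<^sub>0"
    using add_of_nat_notin_nonpos_Ints[OF c, of 1] by simp
  have summ: "summable ?t" "summable ?t'"
    using assms(2) by (intro summable_norm_cancel[OF summable_norm_fps_2F1_nth] c c1; simp)+
  have tele: "c * (c - a - b) * ?t n - (c - a) * (c - b) * ?t' n
                = c * (of_nat n * ?t n) - c * (of_nat (Suc n) * ?t (Suc n))" for n
  proof -
    have nz: "c + of_nat n \<noteq> 0" "c \<noteq> 0"
      using add_of_nat_neq_0[OF c, of n] add_of_nat_neq_0[OF c, of 0] by auto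
    have "(c + of_nat n) * pochhammer c n = c * pochhammer (c + 1) n"
      by (metis pochhammer_rec pochhammer_Suc mult.commute)
    moreover have "pochhammer c n \<noteq> 0" "pochhammer (c + 1) n \<noteq> 0"
      using c c1 pochhammer_eq_0_imp_nonpos_Int by blast+
    ultimately have t': "?t' n = c / (c + of_nat n) * ?t n"
      unfolding fps_2F1_nth using nz by (simp add: divide_simps mult_ac)
    have "of_nat (Suc n) * ?t (Suc n) = (a + of_nat n) * (b + of_nat n) / (c + of_nat n) * ?t n"
      by (subst fps_2F1_nth_Suc) (simp del: of_nat_Suc fps_hypergeo_nth)
    \<comment> \<open>Multiplied by c + n and divided by c, both sides equal n (c - a - b) - a
      b.\<close>
    moreover have "c * (c - a - b) - (c - a) * (c - b) * (c / (c + of_nat n))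
        = c * of_nat n - c * ((a + of_nat n) * (b + of_nat n) / (c + of_nat n))"
      using nz by (simp add: divide_simps) (simp add: algebra_simps)
    ultimately show ?thesis
      unfolding t' by (metis (no_types, opaque_lifting) left_diff_distrib mult.assoc)
  qed
  have "(\<lambda>n. c * (of_nat n * ?t n)) \<longlonglongrightarrow> c * 0"
    by (intro tendsto_intros of_nat_mult_fps_2F1_nth_tendsto_0 assms)
  from telescope_sums'[OF this]
  have "(\<lambda>n. c * (c - a - b) * ?t n - (c - a) * (c - b) * ?t' n) sums 0"
    unfolding tele by simp
  moreover have "(\<lambda>n. c * (c - a - b) * ?t n - (c - a) * (c - b) * ?t' n) sums
      (c * (c - a - b) * suminf ?t - (c - a) * (c - b) * suminf ?t')"
    by (intro sums_diff sums_mult summable_sums summ)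
  ultimately show ?thesis
    using sums_unique2 by fastforce
qed

text \<open>Iterating the contiguous relation moves \<open>c\<close> to c + n at the price of
  Pochhammer symbols. Normalised as Gauss products these tend to values of 1/Gamma, while the
  shifted sum tends to 1. The factors \<open>rGamma\<close> cover the case of c - a or c - b being a
  pole of Gamma.\<close>

theorem Gauss_summation:
  assumes c: "c \<notin> \<int>\<^sub>\<le>\<^sub>0" and "Re (c - a - b) > 0"
  shows "(\<Sum>n. fps_2F1 a b c $ n)
           = Gamma c * Gamma (c - a - b) * (rGamma (c - a) * rGamma (c - b))"
proof -
  define S where "S = (\<lambda>c. \<Sum>n. fps_2F1 a b c $ n)"
  have iter: "pochhammer c n * pochhammer (c - a - b) n * S c
                = pochhammer (c - a) n * pochhammer (c - b) n * S (c + of_nat n)" for n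
  proof (induction n)
    case (Suc n)
    have *: "(c + of_nat n) * (c - a - b + of_nat n) * S (c + of_nat n)
            = (c - a + of_nat n) * (c - b + of_nat n) * S (c + of_nat (Suc n))"
      using suminf_fps_2F1_contiguous[OF add_of_nat_notin_nonpos_Ints[OF c, of n], of a b] assms(2)
      by (simp add: S_def algebra_simps del: fps_hypergeo_nth)
    have "pochhammer c (Suc n) * pochhammer (c - a - b) (Suc n) * S c
            = (c + of_nat n) * (c - a - b + of_nat n)
                * (pochhammer c n * pochhammer (c - a - b) n * S c)"
      by (simp add: pochhammer_Suc mult_ac)
    also have "\<dots> = pochhammer (c - a) n * pochhammer (c - b) n *
                    ((c + of_nat n) * (c - a - b + of_nat n) * S (c + of_nat n))"
      unfolding Suc.IH by (simp only: mult_ac)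
    finally show ?case
      unfolding * by (simp only: pochhammer_Suc mult_ac)
  qed simp
  have series: "rGamma_series c n * rGamma_series (c - a - b) n * S c
      = rGamma_series (c - a) n * rGamma_series (c - b) n * S (c + of_nat (Suc n))" for n
  proof -
    let ?e = "\<lambda>x. exp (x * complex_of_real (ln (of_nat n)))"
    \<comment> \<open>The normalising factors agree on both sides because c + (c - a - b) = (c - a)
      + (c - b).\<close>
    have "?e c * ?e (c - a - b) = ?e (c - a) * ?e (c - b)"
      unfolding exp_add[symmetric] by (simp add: algebra_simps)
    hence e: "(fact n * ?e c) * (fact n * ?e (c - a - b)) = (fact n * ?e (c - a)) * (fact n * ?e (c - b))"
      by (simp add: mult_ac)
    have quot: "p / x * (q / y) * t = p * q * t / (x * y)" for p q t x y :: complex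
      by simp
    show ?thesis
      unfolding rGamma_series_def quot e
      by (simp only: iter Suc_eq_plus1)
  qed
  have "(\<lambda>n. rGamma_series (c - a) n * rGamma_series (c - b) n * S (c + of_nat (Suc n)))
          \<longlonglongrightarrow> rGamma (c - a) * rGamma (c - b) * 1"
    using suminf_fps_2F1_shift_tendsto_1[of a b c] unfolding S_def
    by (intro tendsto_mult rGamma_series_LIMSEQ LIMSEQ_Suc)
  moreover have "(\<lambda>n. rGamma_series c n * rGamma_series (c - a - b) n * S c)
          \<longlonglongrightarrow> rGamma c * rGamma (c - a - b) * S c"
    by (intro tendsto_intros)
  ultimately have "rGamma c * rGamma (c - a - b) * S c = rGamma (c - a) * rGamma (c - b)"
    unfolding series using LIMSEQ_unique by fastforce
  moreover have "c - a - b \<notin> \<int>\<^sub>\<le>\<^sub>0"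
    using assms(2) by (metis complex_Re_of_nat neg_le_0_iff_le nonpos_Ints_cases' not_less
        of_nat_0_le_iff uminus_complex.sel(1))
  hence "rGamma c \<noteq> 0" "rGamma (c - a - b) \<noteq> 0"
    using c by (simp_all add: rGamma_eq_zero_iff)
  ultimately show ?thesis
    unfolding S_def Gamma_def by (simp add: field_simps del: fps_hypergeo_nth)
qed

section \<open>The derivative at 1 and difference quotients in the disc\<close>

text \<open>Differentiation raises all three parameters by 1 and produces the factor a b / c.
  Gauss's theorem applies with c - a - b lowered by 1, and Gamma (c + 1) = c Gamma c removes the
  denominator.\<close>

lemma suminf_of_nat_mult_fps_2F1:
  assumes c: "c \<notin> \<int>\<^sub>\<le>\<^sub>0" and "Re (c - a - b) > 1"
  shows "(\<Sum>n. of_nat n * fps_2F1 a b c $ n)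
           = a * b * (Gamma c * Gamma (c - a - b - 1) * (rGamma (c - a) * rGamma (c - b)))"
proof -
  have c0: "c \<noteq> 0" and c1: "c + 1 \<notin> \<int>\<^sub>\<le>\<^sub>0"
    using c add_of_nat_notin_nonpos_Ints[OF c, of 1] by auto
  have "norm (of_nat n * fps_2F1 a b c $ n) = real n * norm (fps_2F1 a b c $ n)" for n
    by (simp only: norm_mult norm_of_nat)
  hence "summable (\<lambda>n. norm (of_nat n * fps_2F1 a b c $ n))"
    using summable_of_nat_mult_norm_fps_2F1_nth[OF assms] by (simp only:)
  hence "summable (\<lambda>n. of_nat n * fps_2F1 a b c $ n)"
    by (rule summable_norm_cancel)
  from suminf_split_head[OF this]
  have "(\<Sum>n. of_nat n * fps_2F1 a b c $ n) = (\<Sum>n. of_nat (Suc n) * fps_2F1 a b c $ Suc n)"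
    by (simp only: of_nat_0 mult_zero_left diff_zero)
  also have "\<dots> = (\<Sum>n. a * b / c * fps_2F1 (a + 1) (b + 1) (c + 1) $ n)"
    unfolding fps_2F1_nth pochhammer_rec fact_Suc
    by (intro suminf_cong) (simp add: mult_ac del: of_nat_Suc)
  also have "\<dots> = a * b / c * (\<Sum>n. fps_2F1 (a + 1) (b + 1) (c + 1) $ n)"
    using assms(2) by (intro suminf_mult summable_norm_cancel[OF summable_norm_fps_2F1_nth] c1) simp
  also have "(\<Sum>n. fps_2F1 (a + 1) (b + 1) (c + 1) $ n)
               = c * Gamma c * Gamma (c - a - b - 1) * (rGamma (c - a) * rGamma (c - b))"
    using assms(2) Gamma_plus1[OF c]
    by (subst Gauss_summation[OF c1]) (simp_all add: algebra_simps)
  finally show ?thesis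
    using c0 by simp
qed

text \<open>The quotient (z^n - 1) / (z - 1) is a geometric sum of n terms, of modulus at most n
  throughout the disc. So n |f n| is a majorant independent of z, and no restriction to a Stolz
  angle arises.\<close>

lemma powser_difference_quotient_tendsto:
  fixes f :: "nat \<Rightarrow> complex"
  assumes summ: "summable (\<lambda>n. real n * norm (f n))"
  shows "((\<lambda>z. ((\<Sum>n. f n * z ^ n) - (\<Sum>n. f n)) / (z - 1)) \<longlongrightarrow> (\<Sum>n. of_nat n * f n))
           (at 1 within {z. norm z < 1})"
    (is "(_ \<longlongrightarrow> _) ?F")
\<comment> \<open>Tannery's theorem asks for a nontrivial filter; along the trivial one every limit
  holds.\<close>
proof (cases "?F = bot")
  case nontriv: False
  let ?q = "\<lambda>n z. f n * (\<Sum>i<n. z ^ i)"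
  have abs_summ: "summable (\<lambda>n. norm (f n))"
  proof (rule summable_comparison_test'[OF summ, of 1])
    fix n :: nat
    assume "n \<ge> 1"
    hence "1 * norm (f n) \<le> real n * norm (f n)"
      by (intro mult_right_mono) auto
    thus "norm (norm (f n)) \<le> real n * norm (f n)"
      by simp
  qed
  have ev: "eventually (\<lambda>z. norm z < 1 \<and> z \<noteq> (1 :: complex)) ?F"
    by (auto simp: eventually_at_filter)
  have bound: "norm (?q n z) \<le> real n * norm (f n)" if "norm z < 1" for n z
  proof -
    have "norm (\<Sum>i<n. z ^ i) \<le> (\<Sum>i<n. 1)"
      using that by (intro sum_norm_le) (auto simp: norm_power intro: power_le_one)
    thus ?thesis
      using mult_left_mono[of _ _ "norm (f n)"] by (fastforce simp: norm_mult mult.commute)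
  qed
  have ev_bound: "eventually (\<lambda>(n, z). norm (?q n z) \<le> real n * norm (f n)) (at_top \<times>\<^sub>F ?F)"
    unfolding eventually_prod_filter
    using bound ev by (intro exI[of _ "\<lambda>_. True"] exI[of _ "\<lambda>z. norm z < 1 \<and> z \<noteq> 1"]) auto
  have lim: "((\<lambda>z. ?q n z) \<longlongrightarrow> f n * (\<Sum>i<n. 1 ^ i)) ?F" for n
    by (intro tendsto_intros)
  have "((\<lambda>z. \<Sum>n. ?q n z) \<longlongrightarrow> (\<Sum>n. f n * (\<Sum>i<n. 1 ^ i))) ?F"
    using tannerys_theorem[OF lim ev_bound summ nontriv] by blast
  moreover have "eventually (\<lambda>z. (\<Sum>n. ?q n z)
      = ((\<Sum>n. f n * z ^ n) - (\<Sum>n. f n)) / (z - 1)) ?F"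
    using ev
  proof eventually_elim
    case (elim z)
    have s: "summable (\<lambda>n. f n * z ^ n)"
    proof (rule summable_norm_cancel, rule summable_comparison_test'[OF abs_summ])
      fix n show "norm (norm (f n * z ^ n)) \<le> norm (f n)"
        using elim by (simp add: norm_mult norm_power mult_left_le power_le_one)
    qed
    have q: "summable (\<lambda>n. ?q n z)"
      by (rule summable_norm_cancel, rule summable_comparison_test'[OF summ])
         (use bound elim in auto)
    have "(z - 1) * (\<Sum>n. ?q n z) = (\<Sum>n. (z - 1) * ?q n z)"
      by (intro suminf_mult[symmetric] q)
    also have "\<dots> = (\<Sum>n. f n * z ^ n - f n)"
    proof (intro suminf_cong)
      fix n
      have "(z - 1) * ?q n z = f n * (z ^ n - 1)"
        by (simp only: power_diff_1_eq mult.left_commute)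
      thus "(z - 1) * ?q n z = f n * z ^ n - f n"
        by (simp only: right_diff_distrib mult_1_right)
    qed
    also have "\<dots> = (\<Sum>n. f n * z ^ n) - (\<Sum>n. f n)"
      by (intro suminf_diff[symmetric] s summable_norm_cancel[OF abs_summ])
    finally show ?case
      using elim by (simp add: field_simps)
  qed
  ultimately show ?thesis
    by (simp add: tendsto_cong mult.commute)
qed simp

section \<open>Asymptotics at 1 and cancellation of the poles\<close>

text \<open>By Euler's transformation the product is G(z) / (1 - z). Subtracting the pole G(1) / (1
  - z) leaves minus the difference quotient of G at 1, which tends to -G'(1).\<close>

lemma hypergeo_2F1_asymp:
  assumes c: "c \<notin> \<int>\<^sub>\<le>\<^sub>0" and s: "Re (a + b - c - 1) > 0"
  shows "((\<lambda>z. (1 - z) powr (a + b - c - 1) * hypergeo_2F1 a b c z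
              - Gamma c * Gamma (a + b - c) * (rGamma a * rGamma b) / (1 - z))
          \<longlongrightarrow> - ((c - a) * (c - b) * (Gamma c * Gamma (a + b - c - 1) * (rGamma a * rGamma b))))
         (at 1 within {z. norm z < 1})"
proof -
  let ?G = "fps_2F1 (c - a) (c - b) c"
  have eq: "c - (c - a) = a" "c - (c - b) = b" "a - (c - b) = a + b - c"
    by simp_all
  have Re: "Re (c - (c - a) - (c - b)) > 1"
    using s by simp
  have sum: "(\<Sum>n. ?G $ n) = Gamma c * Gamma (a + b - c) * (rGamma a * rGamma b)"
    using Gauss_summation[OF c, of "c - a" "c - b"] Re unfolding eq by simp
  have "((\<lambda>z. - ((eval_fps ?G z - (\<Sum>n. ?G $ n)) / (z - 1)))
          \<longlongrightarrow> - (\<Sum>n. of_nat n * ?G $ n)) (at 1 within {z. norm z < 1})"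
    unfolding eval_fps_def
    by (intro tendsto_minus powser_difference_quotient_tendsto
          summable_of_nat_mult_norm_fps_2F1_nth c Re)
  moreover have "eventually (\<lambda>z. - ((eval_fps ?G z - (\<Sum>n. ?G $ n)) / (z - 1))
      = (1 - z) powr (a + b - c - 1) * hypergeo_2F1 a b c z - (\<Sum>n. ?G $ n) / (1 - z))
      (at 1 within {z. norm z < 1})"
    unfolding eventually_at_filter
  proof (intro always_eventually allI impI)
    fix z :: complex
    assume z: "z \<noteq> 1" "z \<in> {z. norm z < 1}"
    have "hypergeo_2F1 a b c z = (1 - z) powr (c - a - b) * eval_fps ?G z"
      unfolding hypergeo_2F1_eq_eval_fps using z by (intro eval_fps_2F1_Euler c) simp
    moreover have "(1 - z) powr (a + b - c - 1) * (1 - z) powr (c - a - b) = (1 - z) powr (- 1)"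
      by (simp flip: powr_add)
    hence "(1 - z) powr (a + b - c - 1) * (1 - z) powr (c - a - b) = 1 / (1 - z)"
      using z by (simp add: powr_minus divide_inverse)
    ultimately have "(1 - z) powr (a + b - c - 1) * hypergeo_2F1 a b c z = eval_fps ?G z / (1 - z)"
      by (metis mult.assoc mult_1 times_divide_eq_left)
    thus "- ((eval_fps ?G z - (\<Sum>n. ?G $ n)) / (z - 1))
      = (1 - z) powr (a + b - c - 1) * hypergeo_2F1 a b c z - (\<Sum>n. ?G $ n) / (1 - z)"
      by (metis diff_divide_distrib minus_diff_eq minus_divide_right)
  qed
  ultimately show ?thesis
    unfolding suminf_of_nat_mult_fps_2F1[OF c Re] unfolding eq sum
    by (rule Lim_transform_eventually)
qed

theorem theorem1p1:
  fixes \<alpha> \<beta> :: nat and a b c :: complex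
  assumes "c \<notin> \<int>\<^sub>\<le>\<^sub>0"
    and "a - b \<in> \<nat>"
    and "Re (a + b + of_nat \<alpha> + of_nat \<beta> - c - 1) > 0"
  shows "((\<lambda>z. (1 - z) powr (a + b + of_nat \<alpha> + of_nat \<beta> - c - 1) *
            (pochhammer a \<alpha> * pochhammer b \<beta> *
               hypergeo_2F1 (a + of_nat \<alpha>) (b + of_nat \<beta>) c z
             - pochhammer a \<beta> * pochhammer b \<alpha> *
               hypergeo_2F1 (a + of_nat \<beta>) (b + of_nat \<alpha>) c z))
          \<longlongrightarrow> Gamma c * (rGamma a * rGamma b) *
            Gamma (a + b + of_nat \<alpha> + of_nat \<beta> - c - 1) *
            (a - b) * (of_nat \<alpha> - of_nat \<beta>))
         (at 1 within {z. norm z < 1})"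
proof -
  define s where "s = a + b + of_nat \<alpha> + of_nat \<beta> - c"
  define R where "R = rGamma a * rGamma b"
  \<comment> \<open>The functional equation in terms of 1/Gamma, free of exceptions at poles: the
    scaled constants do not depend on \<open>m\<close> and \<open>n\<close>.\<close>
  have R: "pochhammer a m * pochhammer b n * (rGamma (a + of_nat m) * rGamma (b + of_nat n)) = R"
    for m n
    by (simp add: R_def pochhammer_rGamma[of a m] pochhammer_rGamma[of b n])
  \<comment> \<open>Only the sum of \<open>m\<close> and \<open>n\<close> enters the exponent and
    the pole, so one statement serves both hypergeometric functions.\<close>
  have lim: "((\<lambda>z. pochhammer a m * pochhammer b n *
                ((1 - z) powr (s - 1) * hypergeo_2F1 (a + of_nat m) (b + of_nat n) c z)
              - Gamma c * Gamma s * R / (1 - z))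
          \<longlongrightarrow> - ((c - (a + of_nat m)) * (c - (b + of_nat n)) * (Gamma c * Gamma (s - 1) * R)))
         (at 1 within {z. norm z < 1})"
    if mn: "of_nat m + of_nat n = (of_nat \<alpha> + of_nat \<beta> :: complex)" for m n
  proof -
    have s: "a + of_nat m + (b + of_nat n) - c = s"
      using mn unfolding s_def by (simp add: algebra_simps)
    have "Re (a + of_nat m + (b + of_nat n) - c - 1) > 0"
      unfolding s s_def by (rule assms(3))
    from tendsto_mult_left[OF hypergeo_2F1_asymp[OF assms(1) this],
          of "pochhammer a m * pochhammer b n"]
    show ?thesis
      unfolding s R[symmetric, of m n]
      by (simp add: algebra_simps)
  qed
  show ?thesis
    \<comment> \<open>The poles are identical and drop out; the difference of the two limits
      contains the factor (a - b)(\<alpha> - \<beta>).\<close>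
    using tendsto_diff[OF lim[of \<alpha> \<beta>] lim[of \<beta> \<alpha>]]
    unfolding s_def[symmetric] R_def[symmetric]
    by (simp add: algebra_simps)
qed

end
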